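(* Every vertex tree-shift is a Markov tree-shift. Conversely, every tree-shift of finite type is conjugate to a vertex tree-shift.
   Context: Let $\Sigma=\{0,1\}$, let $\Sigma^n$ be the set of words of length $n$ over $\Sigma$ ($\Sigma^0=\{\epsilon\}$), $\Sigma^*=\bigcup_{n\ge 0}\Sigma^n$, and $\Sigma_n=\bigcup_{k=0}^n\Sigma^k$. A (infinite) tree over a finite alphabet $\mathcal{A}$ is a function $t:\Sigma^*\to\mathcal{A}$; write $t_x=t(x)$. A pattern is a function $u:L\to\mathcal{A}$ with $L\subset\Sigma^*$ finite and prefix-closed (its support). $u$ is a pattern of a tree $t$ rooted at $x$ if $u_y=t_{xy}$ for all $y\in L$; $t$ avoids $u$ if $u$ is not a pattern of $t$ rooted at any node. A tree-shift is a set of trees of the form $X=\mathsf{X}_{\mathcal{F}}=\{t: t \text{ avoids every } u\in\mathcal{F}\}$ for some collection $\mathcal{F}$ of patterns (a forbidden set). An $n$-block is a pattern with support $\Sigma_{n-1}$; $B_n(X)$ is the set of all $n$-blocks that are patterns of some tree in $X$. $X$ is a tree-shift of finite type if it has a finite forbidden set; it is a Markov tree-shift if it has a (finite) forbidden set consisting of $2$-blocks. Sliding block code: for tree-shifts $X$ over $\mathcal{A}$ and $Y$ over $\mathcal{A}'$, a map $\phi:X\to Y$ is a sliding block code if there are a positive integer $k$ and a map $\Phi:B_k(X)\to\mathcal{A}'$ such that, for all $t\in X$, $x\in\Sigma^*$, $\phi(t)_x=\Phi(u)$, where $u$ is the $k$-block of $t$ rooted at $x$. $X$ and $Y$ are conjugate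 if there is a sliding block code $X\to Y$ that has an inverse $Y\to X$ which is also a sliding block code. Vertex tree-shift: let $G_0,G_1$ be finite directed graphs with at most one edge from any vertex to any vertex, let $G=G_0\sqcup G_1$ be their disjoint union, and let $A_0,A_1$ be their ($0$-$1$) adjacency matrices, with $A_i$ indexed by $\{0,1,\dots,|\mathcal{V}(G_i)|-1\}$, where $\mathcal{V}(G_i)$ is the vertex set of $G_i$. Let $m=\max\{|\mathcal{V}(G_0)|,|\mathcal{V}(G_1)|\}$ and $\mathcal{A}=\{0,1,\dots,m-1\}$ (entries of $A_i$ outside its index range are read as $0$). The vertex tree-shift of $G$ is $\mathsf{X}_G=\{t\in\mathcal{A}^{\Sigma^*}: A_0(t_x,t_{x0})=1 \text{ and } A_1(t_x,t_{x1})=1 \text{ for all } x\in\Sigma^*\}$. *)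

theory Defs
  imports "HOL-Library.Sublist" "Graph_Theory.Pair_Digraph"
begin

text \<open>The letters 0 and 1 are \<^term>\<open>False\<close> and \<^term>\<open>True\<close>; the node \<open>xi\<close> below \<open>x\<close> is \<open>x @ [i]\<close>.
  Alphabets are explicit finite sets, since the alphabet of a vertex tree-shift depends on the graph.\<close>

type_synonym node = "bool list"
type_synonym 'a tree = "node \<Rightarrow> 'a"

definition trees :: "'a set \<Rightarrow> 'a tree set" where
  "trees A = {t. \<forall>x. t x \<in> A}"

text \<open>A pattern \<open>u : L \<rightarrow> A\<close> is a partial function with domain \<open>L\<close>.\<close>

type_synonym 'a pattern = "node \<rightharpoonup> 'a"

definition prefix_closed :: "node set \<Rightarrow> bool" where
  "prefix_closed L \<longleftrightarrow> (\<forall>y\<in>L. \<forall>x. prefix x y \<longrightarrow> x \<in> L)"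

definition patterns :: "'a set \<Rightarrow> 'a pattern set" where
  "patterns A = {u. finite (dom u) \<and> prefix_closed (dom u) \<and> ran u \<subseteq> A}"

definition pattern_at :: "'a tree \<Rightarrow> node \<Rightarrow> 'a pattern \<Rightarrow> bool" where
  "pattern_at t x u \<longleftrightarrow> (\<forall>y\<in>dom u. u y = Some (t (x @ y)))"

definition avoids :: "'a tree \<Rightarrow> 'a pattern \<Rightarrow> bool" where
  "avoids t u \<longleftrightarrow> (\<forall>x. \<not> pattern_at t x u)"

definition shift_of :: "'a set \<Rightarrow> 'a pattern set \<Rightarrow> 'a tree set" where
  "shift_of A F = {t \<in> trees A. \<forall>u\<in>F. avoids t u}"

definition forbidden_set :: "'a set \<Rightarrow> 'a tree set \<Rightarrow> 'a pattern set \<Rightarrow> bool" where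
  "forbidden_set A X F \<longleftrightarrow> F \<subseteq> patterns A \<and> X = shift_of A F"

definition tree_shift :: "'a set \<Rightarrow> 'a tree set \<Rightarrow> bool" where
  "tree_shift A X \<longleftrightarrow> finite A \<and> (\<exists>F. forbidden_set A X F)"

text \<open>The support \<open>\<Sigma>\<^sub>n\<^sub>-\<^sub>1\<close> of an \<open>n\<close>-block consists of the words of length less than \<open>n\<close>.\<close>

definition n_blocks :: "'a set \<Rightarrow> nat \<Rightarrow> 'a pattern set" where
  "n_blocks A n = {u \<in> patterns A. dom u = {x. length x < n}}"

definition blocks_of :: "'a set \<Rightarrow> nat \<Rightarrow> 'a tree set \<Rightarrow> 'a pattern set" where
  "blocks_of A n X = {u \<in> n_blocks A n. \<exists>t\<in>X. \<exists>x. pattern_at t x u}"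

definition finite_type :: "'a set \<Rightarrow> 'a tree set \<Rightarrow> bool" where
  "finite_type A X \<longleftrightarrow> finite A \<and> (\<exists>F. finite F \<and> forbidden_set A X F)"

definition markov :: "'a set \<Rightarrow> 'a tree set \<Rightarrow> bool" where
  "markov A X \<longleftrightarrow> finite A \<and> (\<exists>F. finite F \<and> F \<subseteq> n_blocks A 2 \<and> forbidden_set A X F)"

definition block_at :: "nat \<Rightarrow> 'a tree \<Rightarrow> node \<Rightarrow> 'a pattern" where
  "block_at n t x = (\<lambda>y. if length y < n then Some (t (x @ y)) else None)"

definition sliding_block_code ::
    "'a set \<Rightarrow> 'a tree set \<Rightarrow> 'b set \<Rightarrow> 'b tree set \<Rightarrow> ('a tree \<Rightarrow> 'b tree) \<Rightarrow> bool" where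
  "sliding_block_code A X A' Y \<phi> \<longleftrightarrow>
     tree_shift A X \<and> tree_shift A' Y \<and> (\<forall>t\<in>X. \<phi> t \<in> Y) \<and>
     (\<exists>k>0. \<exists>\<Phi>. (\<forall>u\<in>blocks_of A k X. \<Phi> u \<in> A') \<and>
        (\<forall>t\<in>X. \<forall>x. \<phi> t x = \<Phi> (block_at k t x)))"

definition conjugate :: "'a set \<Rightarrow> 'a tree set \<Rightarrow> 'b set \<Rightarrow> 'b tree set \<Rightarrow> bool" where
  "conjugate A X A' Y \<longleftrightarrow>
     (\<exists>\<phi> \<psi>. sliding_block_code A X A' Y \<phi> \<and> sliding_block_code A' Y A X \<psi> \<and>
        (\<forall>t\<in>X. \<psi> (\<phi> t) = t) \<and> (\<forall>s\<in>Y. \<phi> (\<psi> s) = s))"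

text \<open>A \<^locale>\<open>pair_fin_digraph\<close> is a finite directed graph, loops allowed, whose arcs are pairs of
  vertices, so that there is at most one arc from any vertex to any vertex. The map \<open>e\<close> numbers its
  vertices; the adjacency matrix is taken with respect to this numbering, and its entries outside
  the index range are 0.\<close>

definition numbered_digraph :: "'v pair_pre_digraph \<Rightarrow> (nat \<Rightarrow> 'v) \<Rightarrow> bool" where
  "numbered_digraph G e \<longleftrightarrow> pair_fin_digraph G \<and> bij_betw e {..<card (pverts G)} (pverts G)"

definition adjacency_matrix :: "'v pair_pre_digraph \<Rightarrow> (nat \<Rightarrow> 'v) \<Rightarrow> nat \<Rightarrow> nat \<Rightarrow> nat" where
  "adjacency_matrix G e a b =
     (if a < card (pverts G) \<and> b < card (pverts G) \<and> (e a, e b) \<in> parcs G then 1 else 0)"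

definition vertex_alphabet :: "'v pair_pre_digraph \<Rightarrow> 'w pair_pre_digraph \<Rightarrow> nat set" where
  "vertex_alphabet G0 G1 = {..<max (card (pverts G0)) (card (pverts G1))}"

text \<open>The disjoint union of the two graphs is represented by the pair of its parts, which need not
  be disjoint as sets; only their adjacency matrices enter.\<close>

definition vertex_tree_shift ::
    "'v pair_pre_digraph \<Rightarrow> (nat \<Rightarrow> 'v) \<Rightarrow> 'w pair_pre_digraph \<Rightarrow> (nat \<Rightarrow> 'w) \<Rightarrow> nat tree set" where
  "vertex_tree_shift G0 e0 G1 e1 =
     {t \<in> trees (vertex_alphabet G0 G1).
        \<forall>x. adjacency_matrix G0 e0 (t x) (t (x @ [False])) = 1 \<and>
            adjacency_matrix G1 e1 (t x) (t (x @ [True])) = 1}"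

end

theory Submission
  imports Defs
begin

text \<open>A vertex tree-shift forbids exactly the 2-blocks that contain a non-edge. Conversely, if \<open>n\<close>
  exceeds the length of every word in the support of a forbidden pattern of \<open>X\<close>, take as vertices
  the \<open>n\<close>-blocks in which no forbidden pattern occurs at the root, with an edge of \<open>G\<^sub>i\<close>
  from \<open>u\<close> to \<open>v\<close> if \<open>v\<close> agrees with the subtree of \<open>u\<close> at \<open>i\<close> on their overlap. The higher block
  map sends a tree to its \<open>n\<close>-blocks, and its inverse reads off the root symbols.\<close>

lemma finite_words_less: "finite {x :: node. length x < n}"
  by (rule finite_subset[OF _ finite_lists_length_le[of "UNIV :: bool set" n]]) auto

lemma finite_n_blocks:
  assumes "finite A"
  shows "finite (n_blocks A n)"
  by (rule finite_subset[OF _ finite_set_of_finite_maps[OF finite_words_less[of n] assms]])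
    (auto simp: n_blocks_def patterns_def)

lemma block_at_in_n_blocks:
  assumes "t \<in> trees A"
  shows "block_at n t x \<in> n_blocks A n"
proof -
  have dom: "dom (block_at n t x) = {y. length y < n}"
    by (auto simp: block_at_def dom_def)
  have "prefix_closed {y :: node. length y < n}"
    unfolding prefix_closed_def using prefix_length_le le_less_trans by blast
  then show ?thesis
    using assms dom finite_words_less[of n]
    by (auto simp: n_blocks_def patterns_def ran_def block_at_def trees_def split: if_splits)
qed

text \<open>Both patterns are undefined outside the words shorter than \<open>n\<close>, so
  agreement on the support is already equality.\<close>

lemma pattern_at_n_block_iff:
  assumes "u \<in> n_blocks A n"
  shows "pattern_at t x u \<longleftrightarrow> block_at n t x = u"
proof -
  have dom: "dom u = {y. length y < n}"
    using assms by (simp add: n_blocks_def)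
  then have "u y = None" if "\<not> length y < n" for y
    using that by auto
  then show ?thesis
    using dom by (auto simp: pattern_at_def block_at_def fun_eq_iff)
qed

lemma n_block_Some:
  assumes "u \<in> n_blocks A n" "length y < n"
  shows "\<exists>a\<in>A. u y = Some a"
proof -
  have "y \<in> dom u"
    using assms by (simp add: n_blocks_def)
  then obtain a where "u y = Some a"
    by blast
  then show ?thesis
    using assms(1) by (auto simp: n_blocks_def patterns_def dest: ranI)
qed

text \<open>A violation of \<open>P\<close> between a node and its child is visible in the 2-block
  at that node. The lemma serves both directions: for vertex tree-shifts, and for the image of the
  higher block map.\<close>

lemma markov_nearest_neighbour:
  assumes "finite A"
  shows "markov A {t \<in> trees A. \<forall>x i. P i (t x) (t (x @ [i]))}"
proof -
  \<comment> \<open>The symbol at the other child is arbitrary, so a single bad edge in a tree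
    already produces a member of \<open>F\<close>.\<close>
  define F where "F = {u \<in> n_blocks A 2. \<exists>i a b. u [] = Some a \<and> u [i] = Some b \<and> \<not> P i a b}"
  have "(\<forall>u\<in>F. avoids t u) \<longleftrightarrow> (\<forall>x i. P i (t x) (t (x @ [i])))" if t: "t \<in> trees A" for t
  proof
    assume avoid: "\<forall>u\<in>F. avoids t u"
    show "\<forall>x i. P i (t x) (t (x @ [i]))"
    proof (intro allI, rule ccontr)
      fix x i
      assume "\<not> P i (t x) (t (x @ [i]))"
      then have "block_at 2 t x \<in> F"
        using block_at_in_n_blocks[OF t, of 2 x] by (auto simp: F_def block_at_def)
      moreover have "pattern_at t x (block_at 2 t x)"
        by (auto simp: pattern_at_def block_at_def split: if_splits)
      ultimately show False
        using avoid by (auto simp: avoids_def)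
    qed
  next
    assume P: "\<forall>x i. P i (t x) (t (x @ [i]))"
    show "\<forall>u\<in>F. avoids t u"
    proof
      fix u
      assume u: "u \<in> F"
      show "avoids t u"
        unfolding avoids_def
      proof (intro allI notI)
        fix x
        assume "pattern_at t x u"
        then have "block_at 2 t x = u"
          using u pattern_at_n_block_iff[of u A 2 t x] by (simp add: F_def)
        then show False
          using u P by (auto simp: F_def block_at_def)
      qed
    qed
  qed
  then have "{t \<in> trees A. \<forall>x i. P i (t x) (t (x @ [i]))} = shift_of A F"
    by (auto simp: shift_of_def)
  moreover have "F \<subseteq> n_blocks A 2" "finite F"
    using finite_n_blocks[OF assms, of 2] by (auto simp: F_def)
  moreover from this have "F \<subseteq> patterns A"
    by (auto simp: n_blocks_def)
  ultimately show ?thesis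
    using assms by (auto simp: markov_def forbidden_set_def)
qed

lemma markov_vertex_tree_shift:
  "markov (vertex_alphabet G0 G1) (vertex_tree_shift G0 e0 G1 e1)"
proof -
  define P where "P i a b \<longleftrightarrow>
    (if i then adjacency_matrix G1 e1 a b = 1 else adjacency_matrix G0 e0 a b = 1)" for i a b
  have "vertex_tree_shift G0 e0 G1 e1 =
      {t \<in> trees (vertex_alphabet G0 G1). \<forall>x i. P i (t x) (t (x @ [i]))}"
    by (auto simp: vertex_tree_shift_def P_def all_bool_eq)
  then show ?thesis
    using markov_nearest_neighbour[of "vertex_alphabet G0 G1" P]
    by (simp add: vertex_alphabet_def)
qed

lemma markov_imp_tree_shift: "markov A X \<Longrightarrow> tree_shift A X"
  by (auto simp: markov_def tree_shift_def)

lemma finite_type_imp_tree_shift: "finite_type A X \<Longrightarrow> tree_shift A X"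
  by (auto simp: finite_type_def tree_shift_def)

text \<open>Only occurrences at the root are excluded; one further down is caught by the block
  rooted there.\<close>

definition admissible_blocks :: "'a set \<Rightarrow> 'a pattern set \<Rightarrow> nat \<Rightarrow> 'a pattern set" where
  "admissible_blocks A F n = {u \<in> n_blocks A n. \<forall>f\<in>F. \<not> f \<subseteq>\<^sub>m u}"

text \<open>The bound keeps \<open>i # y\<close> in the support of an \<open>n\<close>-block and
  leaves the deepest level of \<open>v\<close> free. For \<open>n = 1\<close> there is no
  constraint.\<close>

definition overlaps :: "nat \<Rightarrow> bool \<Rightarrow> 'a pattern \<Rightarrow> 'a pattern \<Rightarrow> bool" where
  "overlaps n i u v \<longleftrightarrow> (\<forall>y. Suc (length y) < n \<longrightarrow> v y = u (i # y))"

lemma pattern_at_iff_map_le_block_at: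
  assumes "\<forall>y\<in>dom f. length y < n"
  shows "pattern_at t x f \<longleftrightarrow> f \<subseteq>\<^sub>m block_at n t x"
  using assms by (auto simp: pattern_at_def map_le_def block_at_def)

text \<open>Every support fits into an \<open>n\<close>-block, so the block at \<open>x\<close>
  alone decides whether a forbidden pattern occurs at \<open>x\<close>.\<close>

lemma shift_of_iff_admissible:
  assumes "\<forall>f\<in>F. \<forall>y\<in>dom f. length y < n" and "t \<in> trees A"
  shows "t \<in> shift_of A F \<longleftrightarrow> (\<forall>x. block_at n t x \<in> admissible_blocks A F n)"
  using assms pattern_at_iff_map_le_block_at[of _ n t] block_at_in_n_blocks[OF assms(2), of n]
  by (auto simp: shift_of_def avoids_def admissible_blocks_def)

lemma overlaps_block_at: "overlaps n i (block_at n t x) (block_at n t (x @ [i]))"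
  by (auto simp: overlaps_def block_at_def)

text \<open>This makes the higher block map surjective: a compatible family of blocks is the family
  of blocks of the tree of its root symbols.\<close>

lemma block_at_root_symbols:
  assumes blocks: "\<And>x. s x \<in> n_blocks A n" and "0 < n"
    and overlap: "\<And>x i. overlaps n i (s x) (s (x @ [i]))"
  shows "block_at n (\<lambda>x. the (s x [])) x = s x"
proof -
  \<comment> \<open>Descending along \<open>y\<close>, each overlap moves the first letter of the
    word from the argument into the base point, until the symbol sits at a root.\<close>
  have shift: "length y < n \<Longrightarrow> s x y = s (x @ y) []" for x y
  proof (induction y arbitrary: x)
    case (Cons i y)
    then have "s x (i # y) = s (x @ [i]) y"
      using overlap[of i x] by (auto simp: overlaps_def)
    then show ?case
      using Cons by simp
  qed simp
  show ?thesis
  proof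
    fix y
    show "block_at n (\<lambda>x. the (s x [])) x y = s x y"
    proof (cases "length y < n")
      case True
      then show ?thesis
        using n_block_Some[OF blocks[of "x @ y"], of "[]"] \<open>0 < n\<close> shift[of y x]
        by (auto simp: block_at_def)
    next
      case False
      then have "y \<notin> dom (s x)"
        using blocks[of x] by (simp add: n_blocks_def)
      then show ?thesis
        using False by (simp add: block_at_def domIff)
    qed
  qed
qed

lemma bounded_supports:
  assumes "finite F" "F \<subseteq> patterns A"
  obtains n where "0 < n" "\<forall>f\<in>F. \<forall>y\<in>dom f. length y < n"
proof -
  have fin: "finite (\<Union>f\<in>F. length ` dom f)"
    using assms by (auto simp: patterns_def)
  \<comment> \<open>Inserting 0 keeps \<open>Max\<close> meaningful when there are no words at all;
    \<open>Suc\<close> makes the bound strict and positive.\<close>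
  let ?n = "Suc (Max (insert 0 (\<Union>f\<in>F. length ` dom f)))"
  have "length y < ?n" if "f \<in> F" "y \<in> dom f" for f y
    using that fin by (auto intro!: le_imp_less_Suc Max_ge)
  then show thesis
    using that[of ?n] by blast
qed

text \<open>The vertices are the matrix indices themselves, so \<open>id\<close> can serve as the
  numbering.\<close>

definition range_digraph :: "nat \<Rightarrow> (nat \<Rightarrow> nat \<Rightarrow> bool) \<Rightarrow> nat pair_pre_digraph" where
  "range_digraph N P = \<lparr>pverts = {..<N}, parcs = {(a, b). a < N \<and> b < N \<and> P a b}\<rparr>"

lemma numbered_range_digraph: "numbered_digraph (range_digraph N P) id"
proof -
  have "finite {(a, b). a < N \<and> b < N \<and> P a b}"
    by (rule finite_subset[of _ "{..<N} \<times> {..<N}"]) auto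
  then have "pair_fin_digraph (range_digraph N P)"
    by unfold_locales (auto simp: range_digraph_def)
  then show ?thesis
    by (simp add: numbered_digraph_def range_digraph_def)
qed

lemma vertex_alphabet_range_digraph:
  "vertex_alphabet (range_digraph N P) (range_digraph N Q) = {..<N}"
  by (simp add: vertex_alphabet_def range_digraph_def)

lemma vertex_tree_shift_range_digraph:
  "vertex_tree_shift (range_digraph N (P False)) id (range_digraph N (P True)) id =
     {t \<in> trees {..<N}. \<forall>x i. P i (t x) (t (x @ [i]))}"
  unfolding vertex_tree_shift_def vertex_alphabet_range_digraph
  by (auto simp: adjacency_matrix_def range_digraph_def trees_def all_bool_eq)

lemma finite_type_conjugate_vertex_tree_shift:
  assumes "finite_type A X"
  shows "\<exists>N P. conjugate A X
    (vertex_alphabet (range_digraph N (P False)) (range_digraph N (P True)))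
    (vertex_tree_shift (range_digraph N (P False)) id (range_digraph N (P True)) id)"
proof -
  obtain F where "finite A" "finite F" and F: "F \<subseteq> patterns A" and X: "X = shift_of A F"
    using assms by (auto simp: finite_type_def forbidden_set_def)
  obtain n where "0 < n" and n: "\<forall>f\<in>F. \<forall>y\<in>dom f. length y < n"
    using bounded_supports[OF \<open>finite F\<close> F] .
  \<comment> \<open>An admissible block may occur in no tree of \<open>X\<close>. Those used as
    letters by a tree of \<open>Y\<close> do occur in \<open>X\<close>, as
    \<open>\<psi>_block\<close> and \<open>\<psi>_X\<close> show.\<close>
  define B where "B = admissible_blocks A F n"
  have B: "u \<in> n_blocks A n" if "u \<in> B" for u
    using that by (simp add: B_def admissible_blocks_def)
  have "finite B"
    using finite_subset[OF _ finite_n_blocks[OF \<open>finite A\<close>, of n]] B by blast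
  \<comment> \<open>Blocks are coded as numbers because the alphabet of a vertex tree-shift is an
    initial segment of the naturals.\<close>
  then obtain dec where "bij_betw dec {..<card B} B"
    using ex_bij_betw_nat_finite by (auto simp: atLeast0LessThan)
  define N where "N = card B"
  define enc where "enc = inv_into {..<N} dec"
  have dec: "dec a \<in> B" "enc (dec a) = a" if "a < N" for a
    using that \<open>bij_betw dec _ _\<close>
    by (auto simp: enc_def N_def bij_betw_def intro: inv_into_f_f)
  have enc: "enc u < N" "dec (enc u) = u" if "u \<in> B" for u
    using that \<open>bij_betw dec _ _\<close> inv_into_into[of u dec "{..<N}"]
    by (auto simp: enc_def N_def bij_betw_def f_inv_into_f)
  define P where "P i a b \<longleftrightarrow> overlaps n i (dec a) (dec b)" for i a b
  define Y where "Y = {t \<in> trees {..<N}. \<forall>x i. P i (t x) (t (x @ [i]))}"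
  define \<phi> where "\<phi> t x = enc (block_at n t x)" for t x
  define \<psi> where "\<psi> s x = the (dec (s x) [])" for s :: "nat tree" and x

  have block_B: "block_at n t x \<in> B" if "t \<in> X" for t x
    using that shift_of_iff_admissible[OF n, of t A] by (auto simp: X B_def shift_of_def)
  have \<phi>_Y: "\<phi> t \<in> Y" if "t \<in> X" for t
    using block_B[OF that] by (auto simp: Y_def trees_def \<phi>_def P_def enc overlaps_block_at)
  \<comment> \<open>The decoded letters of \<open>s\<close> form a compatible family. This identity
    yields both that \<psi> maps into \<open>X\<close> and that \<phi> inverts it on
    \<open>Y\<close>.\<close>
  have \<psi>_block: "block_at n (\<psi> s) x = dec (s x)" if "s \<in> Y" for s x
    unfolding \<psi>_def
    by (rule block_at_root_symbols[where A = A])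
      (use that dec(1) B \<open>0 < n\<close> in \<open>auto simp: Y_def trees_def P_def\<close>)
  have root_A: "the (dec a []) \<in> A" if "a < N" for a
    using n_block_Some[OF B[OF dec(1)[OF that]], of "[]"] \<open>0 < n\<close> by auto
  have \<psi>_X: "\<psi> s \<in> X" if "s \<in> Y" for s
  proof -
    have lt: "s x < N" for x
      using that by (auto simp: Y_def trees_def)
    then have "\<psi> s \<in> trees A"
      using root_A by (auto simp: trees_def \<psi>_def)
    then show ?thesis
      using shift_of_iff_admissible[OF n] \<psi>_block[OF that] dec(1) lt by (auto simp: X B_def)
  qed
  have \<psi>\<phi>: "\<psi> (\<phi> t) = t" if "t \<in> X" for t
    using block_B[OF that] \<open>0 < n\<close> by (auto simp: \<psi>_def \<phi>_def enc block_at_def[of n t _])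
  have \<phi>\<psi>: "\<phi> (\<psi> s) = s" if "s \<in> Y" for s
    using that by (auto simp: \<phi>_def \<psi>_block dec(2) Y_def trees_def)

  have X_shift: "tree_shift A X"
    using assms by (rule finite_type_imp_tree_shift)
  have Y_shift: "tree_shift {..<N} Y"
    unfolding Y_def by (intro markov_imp_tree_shift markov_nearest_neighbour) simp
  \<comment> \<open>A block occurring in \<open>X\<close> equals some \<open>block_at n t x\<close>
    with \<open>t\<close> in \<open>X\<close>, hence lies in \<open>B\<close>, where
    \<open>enc\<close> is below \<open>N\<close>.\<close>
  have "\<forall>u\<in>blocks_of A n X. enc u \<in> {..<N}"
    using pattern_at_n_block_iff[of _ A n] block_B enc(1) by (force simp: blocks_of_def)
  then have \<phi>_code: "sliding_block_code A X {..<N} Y \<phi>"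
    unfolding sliding_block_code_def using X_shift Y_shift \<phi>_Y \<open>0 < n\<close>
    by (auto simp: \<phi>_def intro!: exI[of _ n] exI[of _ enc])
  \<comment> \<open>The inverse has window 1: the inner \<open>the\<close> reads the letter of a
    1-block, the outer one the root symbol of the block it codes.\<close>
  have "the (dec (the (u [])) []) \<in> A" if "u \<in> blocks_of {..<N} 1 Y" for u
    using that n_block_Some[of u "{..<N}" 1 "[]"] root_A by (auto simp: blocks_of_def)
  then have \<psi>_code: "sliding_block_code {..<N} Y A X \<psi>"
    unfolding sliding_block_code_def using X_shift Y_shift \<psi>_X
    by (auto simp: \<psi>_def block_at_def
        intro!: exI[of _ "1::nat"] exI[of _ "\<lambda>u. the (dec (the (u [])) [])"])
  have "conjugate A X {..<N} Y"
    unfolding conjugate_def using \<phi>_code \<psi>_code \<psi>\<phi> \<phi>\<psi> by blast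
  then show ?thesis
    unfolding Y_def by (metis vertex_alphabet_range_digraph vertex_tree_shift_range_digraph)
qed

theorem proposition4p2:
  shows "(\<forall>(G0 :: 'v pair_pre_digraph) (G1 :: 'w pair_pre_digraph) e0 e1.
            numbered_digraph G0 e0 \<and> numbered_digraph G1 e1 \<longrightarrow>
            markov (vertex_alphabet G0 G1) (vertex_tree_shift G0 e0 G1 e1)) \<and>
         (\<forall>(A :: 'a set) X. finite_type A X \<longrightarrow>
            (\<exists>(G0 :: nat pair_pre_digraph) (G1 :: nat pair_pre_digraph) e0 e1.
               numbered_digraph G0 e0 \<and> numbered_digraph G1 e1 \<and>
               conjugate A X (vertex_alphabet G0 G1) (vertex_tree_shift G0 e0 G1 e1)))"
proof (intro conjI allI impI)
  show "markov (vertex_alphabet G0 G1) (vertex_tree_shift G0 e0 G1 e1)"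
    for G0 :: "'v pair_pre_digraph" and G1 :: "'w pair_pre_digraph" and e0 e1
    by (rule markov_vertex_tree_shift)
next
  fix A :: "'a set" and X
  assume "finite_type A X"
  then show "\<exists>(G0 :: nat pair_pre_digraph) (G1 :: nat pair_pre_digraph) e0 e1.
      numbered_digraph G0 e0 \<and> numbered_digraph G1 e1 \<and>
      conjugate A X (vertex_alphabet G0 G1) (vertex_tree_shift G0 e0 G1 e1)"
    using finite_type_conjugate_vertex_tree_shift numbered_range_digraph by meson
qed

end
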